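(* There is an absolute constant $C>0$ such that the following holds. Let $\mathcal X\subseteq\mathbb R^d$ be a nonempty closed bounded convex set with diameter $D=\max_{x,y\in\mathcal X}\|x-y\|$, and let $F:\mathcal X\to\mathbb R^d$ be a continuous operator (not necessarily monotone) that is $L_1$-smooth, i.e. $\|\nabla F(x)-\nabla F(y)\|_{\mathrm{op}}\le L_1\|x-y\|$ for all $x,y\in\mathcal X$, and satisfies the Minty condition: there exists $x^*\in\mathcal X$ with $\langle F(x),x-x^*\rangle\ge 0$ for all $x\in\mathcal X$. Let $\delta\ge 0$ and let $J(v)\in\mathbb R^{d\times d}$, $v\in\mathcal X$, be inexact Jacobians with $\|\nabla F(v)-J(v)\|\le\delta$. Then after $T\ge 1$ iterations of the algorithm VIJI with parameters $\beta_k=\delta$ for all $k$ and $\eta=10$, the output $\hat x_T=x_{k_T}$, where $k_T\in\arg\min_{1\le k\le T}\|x_k-v_k\|$ (option $\mathsf{opt}=2$), satisfies $$\sup_{x\in\mathcal X}\langle F(\hat x_T),\hat x_T-x\rangle\le C\left(\frac{L_1D^3}{T}+\frac{\delta D^2}{\sqrt T}\right).$$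
   Context: $\|\cdot\|$ is the Euclidean norm (operator norm for matrices). Inexact model: for $v\in\mathcal X$ and $\eta>0$, $\Psi_v(x)=F(v)+J(v)[x-v]$ and $\Omega_v^\eta(x)=\Psi_v(x)+\eta\delta(x-v)+5L_1\|x-v\|(x-v)$. Algorithm VIJI: given $x_0\in\mathcal X$, $L_1$, $\delta$, $\eta$ and a sequence $\{\beta_k\}$, set $s_0=0\in\mathbb R^d$ and for $k=0,1,2,\dots$: (1) $v_{k+1}=\arg\max_{v\in\mathcal X}\{\langle s_k,v-x_0\rangle-\frac12\|v-x_0\|^2\}$; (2) $x_{k+1}\in\mathcal X$ is any point with $\sup_{x\in\mathcal X}\langle\Omega^\eta_{v_{k+1}}(x_{k+1}),x_{k+1}-x\rangle\le\frac{L_1}{2}\|x_{k+1}-v_{k+1}\|^3+\delta\|x_{k+1}-v_{k+1}\|^2$; (3) $\lambda_{k+1}$ is any number with $\frac1{32}\le\lambda_{k+1}\left(\frac{L_1}{2}\|x_{k+1}-v_{k+1}\|+\beta_{k+1}\right)\le\frac1{22}$; (4) $s_{k+1}=s_k-\lambda_{k+1}F(x_{k+1})$. The iterates are assumed to be generated by this scheme (i.e. points $x_{k+1}$ satisfying (2) are available). *)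

theory Defs
  imports "HOL-Analysis.Analysis"
begin

text \<open>
  The constant of the theorem must not depend on the dimension, so the dimension has to be
  quantified inside the statement and cannot be a type. We therefore work in the inner product
  space of finitely supported real sequences with the Euclidean inner product and render the
  \<open>d\<close>-dimensional Euclidean space as its subspace \<open>Rn d\<close> of vectors supported on the first \<open>d\<close>
  coordinates. The subspace is closed and carries the Euclidean inner product, norm and topology,
  so the library notions (closed, bounded, convex, diameter, continuity, derivative, onorm)
  mean on subsets of \<open>Rn d\<close> what they mean in the usual Euclidean space.
\<close>

typedef evec = "{f :: nat \<Rightarrow> real. finite {i. f i \<noteq> 0}}"
  morphisms coord Abs_evec
  by (rule exI[of _ "\<lambda>_. 0"]) simp

setup_lifting type_definition_evec

lemma evec_eqI: "(\<And>i. coord x i = coord y i) \<Longrightarrow> x = y"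
  by (metis coord_inject ext)

lemma finite_coord: "finite {i. coord x i \<noteq> 0}"
  using coord[of x] by simp

instantiation evec :: real_vector
begin

lift_definition zero_evec :: evec is "\<lambda>_. 0" by simp
lift_definition plus_evec :: "evec \<Rightarrow> evec \<Rightarrow> evec" is "\<lambda>f g i. f i + g i"
  by (erule (1) rev_finite_subset[OF finite_UnI]) auto
lift_definition minus_evec :: "evec \<Rightarrow> evec \<Rightarrow> evec" is "\<lambda>f g i. f i - g i"
  by (erule (1) rev_finite_subset[OF finite_UnI]) auto
lift_definition uminus_evec :: "evec \<Rightarrow> evec" is "\<lambda>f i. - f i" by simp
lift_definition scaleR_evec :: "real \<Rightarrow> evec \<Rightarrow> evec" is "\<lambda>c f i. c * f i"
  by (erule rev_finite_subset) auto

instance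
  by standard (transfer; auto simp: algebra_simps)+

end

lemmas coord_simps [simp] =
  zero_evec.rep_eq plus_evec.rep_eq minus_evec.rep_eq uminus_evec.rep_eq scaleR_evec.rep_eq

instantiation evec :: real_inner
begin

definition inner_evec :: "evec \<Rightarrow> evec \<Rightarrow> real"
  where "inner_evec x y = (\<Sum>i | coord x i \<noteq> 0. coord x i * coord y i)"
definition norm_evec :: "evec \<Rightarrow> real"
  where "norm_evec x = sqrt (inner x x)"
definition sgn_evec :: "evec \<Rightarrow> evec"
  where "sgn_evec x = x /\<^sub>R norm x"
definition dist_evec :: "evec \<Rightarrow> evec \<Rightarrow> real"
  where "dist_evec x y = norm (x - y)"
definition uniformity_evec :: "(evec \<times> evec) filter"
  where "uniformity_evec = (INF e\<in>{0 <..}. principal {(x, y). dist x y < e})"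
definition open_evec :: "evec set \<Rightarrow> bool"
  where "open_evec U \<longleftrightarrow> (\<forall>x\<in>U. eventually (\<lambda>(x', y). x' = x \<longrightarrow> y \<in> U) uniformity)"

lemma inner_evec_superset:
  assumes "finite S" "{i. coord x i \<noteq> 0} \<subseteq> S"
  shows "inner x y = (\<Sum>i\<in>S. coord x i * coord y i)"
  unfolding inner_evec_def by (rule sum.mono_neutral_left) (use assms in auto)

instance
proof
  fix x y z :: evec and r :: real
  define S where "S = {i. coord x i \<noteq> 0} \<union> {i. coord y i \<noteq> 0}"
  have S: "finite S" by (simp add: S_def finite_coord)
  note I = inner_evec_superset[OF S]
  have sub: "{i. coord x i \<noteq> 0} \<subseteq> S" "{i. coord y i \<noteq> 0} \<subseteq> S"
    "{i. coord (x + y) i \<noteq> 0} \<subseteq> S" "{i. coord (r *\<^sub>R x) i \<noteq> 0} \<subseteq> S"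
    by (auto simp: S_def)
  show "inner x y = inner y x" using sub by (simp add: I mult.commute)
  show "inner (x + y) z = inner x z + inner y z"
    using I[OF sub(3)] I[OF sub(1)] I[OF sub(2)] by (simp add: sum.distrib algebra_simps)
  show "inner (r *\<^sub>R x) y = r * inner x y"
    using I[OF sub(4)] I[OF sub(1)] by (simp add: sum_distrib_left algebra_simps)
  show "0 \<le> inner x x" by (simp add: inner_evec_def sum_nonneg)
  show "inner x x = 0 \<longleftrightarrow> x = 0"
  proof
    assume "inner x x = 0"
    hence "\<forall>i\<in>{i. coord x i \<noteq> 0}. coord x i * coord x i = 0"
      unfolding inner_evec_def by (subst (asm) sum_nonneg_eq_0_iff) (auto simp: finite_coord)
    thus "x = 0" by (intro evec_eqI) auto
  qed (simp add: inner_evec_def)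
qed (simp_all only: norm_evec_def sgn_evec_def dist_evec_def uniformity_evec_def open_evec_def)

end

definition Rn :: "nat \<Rightarrow> evec set"
  where "Rn d = {x. \<forall>i\<ge>d. coord x i = 0}"

lemma inner_Rn: "x \<in> Rn d \<Longrightarrow> inner x y = (\<Sum>i<d. coord x i * coord y i)"
  by (rule inner_evec_superset) (auto simp: Rn_def not_less[symmetric])

lemma norm_Rn: "x \<in> Rn d \<Longrightarrow> norm x = L2_set (coord x) {..<d}"
  by (simp add: norm_eq_sqrt_inner inner_Rn L2_set_def power2_eq_square)

text \<open>
  The action of a \<open>d \<times> d\<close> matrix; only the entries \<open>A i j\<close> with \<open>i, j < d\<close> matter. The map is
  defined on all of \<open>evec\<close> but factors through the orthogonal projection onto \<open>Rn d\<close>, so its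
  \<open>onorm\<close> is the Euclidean operator norm of the matrix.
\<close>

lift_definition mat_vec :: "nat \<Rightarrow> (nat \<Rightarrow> nat \<Rightarrow> real) \<Rightarrow> evec \<Rightarrow> evec"
  is "\<lambda>d A x i. if i < d then \<Sum>j<d. A i j * x j else 0"
  by (rule finite_subset[of _ "{..<_}"]) auto

lemma mat_vec_in_Rn: "mat_vec d A x \<in> Rn d"
  by (simp add: Rn_def mat_vec.rep_eq)

lemma bounded_linear_mat_vec: "bounded_linear (mat_vec d A)"
proof -
  have coord_le: "\<bar>coord x i\<bar> \<le> norm x" for x :: evec and i
  proof -
    have "coord x i * coord x i \<le> (\<Sum>j\<in>insert i {j. coord x j \<noteq> 0}. coord x j * coord x j)"
      by (rule member_le_sum) (auto simp: finite_coord)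
    also have "\<dots> = (norm x)\<^sup>2"
      by (subst power2_norm_eq_inner, rule inner_evec_superset[symmetric]) (auto simp: finite_coord)
    finally show ?thesis
      using abs_le_square_iff[of "coord x i" "norm x"] by (simp add: power2_eq_square)
  qed
  have lin: "linear (mat_vec d A)"
    by (rule linearI; rule evec_eqI)
      (simp_all add: mat_vec.rep_eq sum.distrib sum_distrib_left algebra_simps)
  have "norm (mat_vec d A x) \<le> norm x * (\<Sum>i<d. \<Sum>j<d. \<bar>A i j\<bar>)" for x
  proof -
    have "norm (mat_vec d A x) \<le> (\<Sum>i<d. \<bar>coord (mat_vec d A x) i\<bar>)"
      unfolding norm_Rn[OF mat_vec_in_Rn] by (rule L2_set_le_sum_abs)
    also have "\<dots> \<le> (\<Sum>i<d. \<Sum>j<d. \<bar>A i j\<bar> * norm x)"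
    proof (rule sum_mono)
      fix i assume "i \<in> {..<d}"
      have "\<bar>\<Sum>j<d. A i j * coord x j\<bar> \<le> (\<Sum>j<d. \<bar>A i j * coord x j\<bar>)" by (rule sum_abs)
      also have "\<dots> \<le> (\<Sum>j<d. \<bar>A i j\<bar> * norm x)"
        by (rule sum_mono) (simp add: abs_mult mult_left_mono coord_le)
      finally show "\<bar>coord (mat_vec d A x) i\<bar> \<le> (\<Sum>j<d. \<bar>A i j\<bar> * norm x)"
        using \<open>i \<in> {..<d}\<close> by (simp add: mat_vec.rep_eq)
    qed
    finally show ?thesis by (simp add: sum_distrib_left mult.commute)
  qed
  thus ?thesis using lin by (auto simp: bounded_linear_def bounded_linear_axioms_def)
qed

definition mat_norm :: "nat \<Rightarrow> (nat \<Rightarrow> nat \<Rightarrow> real) \<Rightarrow> real"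
  where "mat_norm d A = onorm (mat_vec d A)"

text \<open>
  \<open>DF\<close> is the Jacobian field written \<open>\<nabla>F\<close> in the literature. Since \<open>F\<close> is only given on
  \<open>X\<close>, the derivative is taken within \<open>X\<close>; if \<open>X\<close> has empty interior, \<open>DF\<close> is any field of
  such derivatives.
\<close>

definition jacobian_on ::
  "nat \<Rightarrow> evec set \<Rightarrow> (evec \<Rightarrow> evec) \<Rightarrow> (evec \<Rightarrow> nat \<Rightarrow> nat \<Rightarrow> real) \<Rightarrow> bool"
  where "jacobian_on d X F DF \<longleftrightarrow>
    (\<forall>x\<in>X. (F has_derivative mat_vec d (DF x)) (at x within X))"

definition smooth_jacobian ::
  "nat \<Rightarrow> evec set \<Rightarrow> (evec \<Rightarrow> nat \<Rightarrow> nat \<Rightarrow> real) \<Rightarrow> real \<Rightarrow> bool"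
  where "smooth_jacobian d X DF L1 \<longleftrightarrow>
    (\<forall>x\<in>X. \<forall>y\<in>X. mat_norm d (\<lambda>i j. DF x i j - DF y i j) \<le> L1 * norm (x - y))"

definition inexact_jacobian ::
  "nat \<Rightarrow> evec set \<Rightarrow> (evec \<Rightarrow> nat \<Rightarrow> nat \<Rightarrow> real) \<Rightarrow> (evec \<Rightarrow> nat \<Rightarrow> nat \<Rightarrow> real) \<Rightarrow> real \<Rightarrow> bool"
  where "inexact_jacobian d X DF J \<delta> \<longleftrightarrow>
    (\<forall>v\<in>X. mat_norm d (\<lambda>i j. DF v i j - J v i j) \<le> \<delta>)"

definition minty :: "evec set \<Rightarrow> (evec \<Rightarrow> evec) \<Rightarrow> bool"
  where "minty X F \<longleftrightarrow> (\<exists>xs\<in>X. \<forall>x\<in>X. inner (F x) (x - xs) \<ge> 0)"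

definition Psi ::
  "nat \<Rightarrow> (evec \<Rightarrow> evec) \<Rightarrow> (evec \<Rightarrow> nat \<Rightarrow> nat \<Rightarrow> real) \<Rightarrow> evec \<Rightarrow> evec \<Rightarrow> evec"
  where "Psi d F J v x = F v + mat_vec d (J v) (x - v)"

definition Omega ::
  "nat \<Rightarrow> (evec \<Rightarrow> evec) \<Rightarrow> (evec \<Rightarrow> nat \<Rightarrow> nat \<Rightarrow> real) \<Rightarrow> real \<Rightarrow> real \<Rightarrow> real \<Rightarrow> evec \<Rightarrow> evec \<Rightarrow> evec"
  where "Omega d F J L1 \<delta> \<eta> v x =
    Psi d F J v x + (\<eta> * \<delta>) *\<^sub>R (x - v) + (5 * L1 * norm (x - v)) *\<^sub>R (x - v)"

definition gap :: "evec set \<Rightarrow> (evec \<Rightarrow> evec) \<Rightarrow> evec \<Rightarrow> real"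
  where "gap X G y = (SUP x\<in>X. inner (G y) (y - x))"

text \<open>
  \<open>x\<close>, \<open>v\<close>, \<open>lam\<close>, \<open>s\<close> are the sequences produced by some run of \<open>T\<close> iterations started at
  \<open>x 0\<close>; only the entries with index at most \<open>T\<close> are constrained.
\<close>

definition VIJI_run ::
  "nat \<Rightarrow> evec set \<Rightarrow> (evec \<Rightarrow> evec) \<Rightarrow> (evec \<Rightarrow> nat \<Rightarrow> nat \<Rightarrow> real) \<Rightarrow> real \<Rightarrow> real \<Rightarrow> real
    \<Rightarrow> (nat \<Rightarrow> real) \<Rightarrow> nat \<Rightarrow> (nat \<Rightarrow> evec) \<Rightarrow> (nat \<Rightarrow> evec) \<Rightarrow> (nat \<Rightarrow> real) \<Rightarrow> (nat \<Rightarrow> evec) \<Rightarrow> bool"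
  where "VIJI_run d X F J L1 \<delta> \<eta> \<beta> T x v lam s \<longleftrightarrow>
    x 0 \<in> X \<and> s 0 = 0 \<and>
    (\<forall>k<T.
       is_arg_max (\<lambda>u. inner (s k) (u - x 0) - 1 / 2 * (norm (u - x 0))\<^sup>2) (\<lambda>u. u \<in> X) (v (Suc k)) \<and>
       x (Suc k) \<in> X \<and>
       gap X (Omega d F J L1 \<delta> \<eta> (v (Suc k))) (x (Suc k))
         \<le> L1 / 2 * norm (x (Suc k) - v (Suc k)) ^ 3 + \<delta> * (norm (x (Suc k) - v (Suc k)))\<^sup>2 \<and>
       1 / 32 \<le> lam (Suc k) * (L1 / 2 * norm (x (Suc k) - v (Suc k)) + \<beta> (Suc k)) \<and>
       lam (Suc k) * (L1 / 2 * norm (x (Suc k) - v (Suc k)) + \<beta> (Suc k)) \<le> 1 / 22 \<and>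
       s (Suc k) = s k - lam (Suc k) *\<^sub>R F (x (Suc k)))"

end

theory Submission
  imports Defs
begin

text \<open>
  Write \<open>r\<close> for the length \<open>norm (x - v)\<close> of a step of the method and \<open>a = L1 / 2 * r + \<delta>\<close>.
  Smoothness of \<open>F\<close> and accuracy of the Jacobian give \<open>norm (F x - Psi d F J v x) \<le> a * r\<close>, and
  for \<open>\<eta> = 10\<close> the two regularising terms of \<open>Omega\<close> add up to exactly \<open>10 * a\<close> times \<open>x - v\<close>,
  while the tolerance of the subproblem is \<open>a * r\<^sup>2\<close>. Everything is thus governed by the single
  number \<open>a\<close>, and the step-size rule keeps \<open>lam * a\<close> between two absolute constants.

  The regularisation dominates the model error: \<open>lam * inner (F x) (x - u)\<close> is at most
  \<open>(norm (u - v))\<^sup>2 / 2 - r\<^sup>2 / 8\<close> for all \<open>u \<in> X\<close> (\<open>regularised_step_descent\<close>). The first term is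
  paid for by the strong concavity of the dual averaging objective that defines \<open>v\<close>; telescoping
  (\<open>dual_averaging_regret\<close>) leaves
  \<open>(\<Sum>k. lam k * inner (F (x k)) (x k - u)) + (\<Sum>k. (r k)\<^sup>2) / 8 \<le> (norm (u - x 0))\<^sup>2 / 2\<close>.
  At a Minty solution \<open>u\<close> the first sum is nonnegative. Hence the squared step lengths sum to at
  most \<open>4 * D\<^sup>2\<close>, where \<open>D\<close> is the diameter of \<open>X\<close>, and the shortest of the \<open>T\<close> steps has length at
  most \<open>2 * D / sqrt T\<close>.

  Finally, the approximate solution of the subproblem solves the original problem up to the model
  error and the regularisation, so that its gap is at most \<open>12 * a * r * D\<close>
  (\<open>regularised_step_gap\<close>). The bound on the shortest step turns this into the stated rate with
  \<open>C = 24\<close>.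
\<close>

section \<open>Linearisation error\<close>

text \<open>
  The derivative is only taken within \<open>S\<close>, so the comparison is made along the segment from \<open>v\<close> to
  \<open>x\<close>: at time \<open>t\<close> the remainder moves with speed at most \<open>L * t * (norm (x - v))\<^sup>2\<close>.
\<close>

lemma linearisation_error_Lipschitz_derivative:
  fixes f :: "'a::real_normed_vector \<Rightarrow> 'b::real_normed_vector"
  assumes S: "convex S" "v \<in> S" "x \<in> S"
    and der: "\<And>y. y \<in> S \<Longrightarrow> (f has_derivative D y) (at y within S)"
    and lip: "\<And>y. y \<in> S \<Longrightarrow> onorm (\<lambda>h. D y h - D v h) \<le> L * norm (y - v)"
  shows "norm (f x - f v - D v (x - v)) \<le> L / 2 * (norm (x - v))\<^sup>2"
proof -
  define p where "p t = v + t *\<^sub>R (x - v)" for t :: real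
  define R where "R t = f (p t) - t *\<^sub>R D v (x - v)" for t
  have pS: "p t \<in> S" if "t \<in> {0..1}" for t
    using convexD_alt[OF S, of t] that by (simp add: p_def algebra_simps)
  have lin: "bounded_linear (D y)" if "y \<in> S" for y
    using der[OF that] by (rule has_derivative_bounded_linear)
  have derR: "(R has_vector_derivative D (p t) (x - v) - D v (x - v)) (at t within {0..1})"
    if t: "t \<in> {0..1}" for t
  proof -
    have "(p has_derivative (\<lambda>h. h *\<^sub>R (x - v))) (at t within {0..1})"
      unfolding p_def by (auto intro!: derivative_eq_intros)
    moreover have "(f has_derivative D (p t)) (at (p t) within p ` {0..1})"
      using der[OF pS[OF t]] by (rule has_derivative_subset) (use pS in auto)
    ultimately have "((\<lambda>t. f (p t)) has_derivative (\<lambda>h. D (p t) (h *\<^sub>R (x - v)))) (at t within {0..1})"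
      by (rule has_derivative_in_compose)
    hence "((\<lambda>t. f (p t)) has_vector_derivative D (p t) (x - v)) (at t within {0..1})"
      by (simp add: has_vector_derivative_def
          linear_simps(5)[OF lin[OF pS[OF t]]])
    moreover have "((\<lambda>t. t *\<^sub>R D v (x - v)) has_vector_derivative D v (x - v)) (at t within {0..1})"
      unfolding has_vector_derivative_def by (auto intro!: derivative_eq_intros)
    ultimately show ?thesis
      unfolding R_def by (rule has_vector_derivative_diff)
  qed
  have "norm (R 1 - R 0) \<le> L / 2 * (norm (x - v))\<^sup>2 * 1\<^sup>2 - L / 2 * (norm (x - v))\<^sup>2 * 0\<^sup>2"
  proof (rule differentiable_bound_general
      [where f' = "\<lambda>t. D (p t) (x - v) - D v (x - v)" and \<phi>' = "\<lambda>t. L * (norm (x - v))\<^sup>2 * t"])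
    show "continuous_on {0..1} R"
      using derR by (rule continuous_on_vector_derivative)
    show "continuous_on {0..1} (\<lambda>t. L / 2 * (norm (x - v))\<^sup>2 * t\<^sup>2)"
      by (intro continuous_intros)
  next
    fix t :: real assume t: "0 < t" "t < 1"
    show "(R has_vector_derivative D (p t) (x - v) - D v (x - v)) (at t)"
      using derR[of t] t at_within_Icc_at[of 0 t 1] by simp
    show "((\<lambda>t. L / 2 * (norm (x - v))\<^sup>2 * t\<^sup>2) has_vector_derivative L * (norm (x - v))\<^sup>2 * t) (at t)"
      unfolding has_real_derivative_iff_has_vector_derivative[symmetric]
      by (auto intro!: derivative_eq_intros)
    have "norm (D (p t) (x - v) - D v (x - v)) \<le> onorm (\<lambda>h. D (p t) h - D v h) * norm (x - v)"
      using t S by (intro onorm bounded_linear_sub lin pS) auto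
    also have "\<dots> \<le> L * norm (p t - v) * norm (x - v)"
      using t by (intro mult_right_mono lip pS) auto
    also have "\<dots> = L * (norm (x - v))\<^sup>2 * t"
      using t by (simp add: p_def power2_eq_square)
    finally show "norm (D (p t) (x - v) - D v (x - v)) \<le> L * (norm (x - v))\<^sup>2 * t" .
  qed simp
  thus ?thesis by (simp add: R_def p_def algebra_simps)
qed

lemma mat_vec_diff: "mat_vec d (\<lambda>i j. A i j - B i j) h = mat_vec d A h - mat_vec d B h"
  by (rule evec_eqI) (simp add: mat_vec.rep_eq sum_subtractf left_diff_distrib)

lemma Psi_error:
  assumes X: "convex X" "v \<in> X" "x \<in> X"
    and jac: "jacobian_on d X F DF" "smooth_jacobian d X DF L1" "inexact_jacobian d X DF J \<delta>"
  shows "norm (F x - Psi d F J v x) \<le> (L1 / 2 * norm (x - v) + \<delta>) * norm (x - v)"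
proof -
  let ?E = "\<lambda>i j. DF v i j - J v i j"
  have "norm (F x - F v - mat_vec d (DF v) (x - v)) \<le> L1 / 2 * (norm (x - v))\<^sup>2"
  proof (rule linearisation_error_Lipschitz_derivative[OF X])
    fix y assume y: "y \<in> X"
    show "(F has_derivative mat_vec d (DF y)) (at y within X)"
      using jac(1) y by (simp add: jacobian_on_def)
    show "onorm (\<lambda>h. mat_vec d (DF y) h - mat_vec d (DF v) h) \<le> L1 * norm (y - v)"
      using jac(2) y X by (simp add: smooth_jacobian_def mat_norm_def flip: mat_vec_diff)
  qed
  moreover have "norm (mat_vec d ?E (x - v)) \<le> mat_norm d ?E * norm (x - v)"
    unfolding mat_norm_def by (rule onorm[OF bounded_linear_mat_vec])
  moreover have "mat_norm d ?E * norm (x - v) \<le> \<delta> * norm (x - v)"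
    using jac(3) X by (intro mult_right_mono) (auto simp: inexact_jacobian_def)
  moreover have "F x - Psi d F J v x =
      (F x - F v - mat_vec d (DF v) (x - v)) + mat_vec d ?E (x - v)"
    by (simp add: Psi_def mat_vec_diff)
  moreover have "norm \<dots> \<le> norm (F x - F v - mat_vec d (DF v) (x - v)) + norm (mat_vec d ?E (x - v))"
    by (rule norm_triangle_ineq)
  ultimately show ?thesis
    by (simp add: power2_eq_square algebra_simps)
qed

section \<open>One step of the regularised method\<close>

text \<open>
  In the next two lemmas \<open>g\<close> is the operator value at \<open>x\<close>, \<open>w\<close> the value of its regularised model
  and \<open>a\<close> the regularisation parameter. Since \<open>inner (x - v) (x - u)\<close> is at least
  \<open>r\<^sup>2 - r * norm (u - v)\<close>, the regularisation contributes \<open>-10 * a * r\<^sup>2\<close>, of which the model error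
  and the tolerance consume one \<open>a * r\<^sup>2\<close> each. The cross term \<open>11 * a * r * norm (u - v)\<close> is
  absorbed by completing the square, which the upper bound on \<open>l * a\<close> allows.
\<close>

lemma regularised_step_descent:
  fixes g w x u v :: "'a::real_inner"
  assumes err: "norm (g - (w - (10 * a) *\<^sub>R (x - v))) \<le> a * norm (x - v)"
    and tol: "inner w (x - u) \<le> a * (norm (x - v))\<^sup>2"
    and step: "l \<ge> 0" "1 / 32 \<le> l * a" "l * a \<le> 1 / 22"
  shows "l * inner g (x - u) \<le> (norm (u - v))\<^sup>2 / 2 - (norm (x - v))\<^sup>2 / 8"
proof -
  let ?r = "norm (x - v)" and ?q = "norm (u - v)" and ?m = "l * a"
  let ?e = "g - (w - (10 * a) *\<^sub>R (x - v))"
  have l: "l > 0" using step by (cases "l = 0") auto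
  hence a: "a > 0" using step(2) zero_less_mult_pos[of l a] by linarith
  have tri: "norm (x - u) \<le> ?r + ?q"
    using norm_triangle_ineq4[of "x - v" "u - v"] by simp
  have "inner ?e (x - u) \<le> norm ?e * norm (x - u)"
    by (rule norm_cauchy_schwarz)
  also have "\<dots> \<le> (a * ?r) * (?r + ?q)"
    using err tri a by (intro mult_mono) auto
  finally have e: "inner ?e (x - u) \<le> a * ?r * (?r + ?q)" .
  have "inner (x - v) (x - u) = ?r\<^sup>2 - inner (x - v) (u - v)"
    by (simp add: power2_norm_eq_inner algebra_simps inner_commute)
  hence p: "inner (x - v) (x - u) \<ge> ?r\<^sup>2 - ?r * ?q"
    using norm_cauchy_schwarz[of "x - v" "u - v"] by simp
  have "inner g (x - u) = inner ?e (x - u) + inner w (x - u) - 10 * a * inner (x - v) (x - u)"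
    by (simp add: inner_diff_left)
  also have "\<dots> \<le> a * ?r * (?r + ?q) + a * ?r\<^sup>2 - 10 * a * (?r\<^sup>2 - ?r * ?q)"
    using e tol p a by (intro diff_mono add_mono mult_left_mono) auto
  also have "\<dots> = a * (11 * ?r * ?q - 8 * ?r\<^sup>2)"
    by (simp add: power2_eq_square algebra_simps)
  finally have "l * inner g (x - u) \<le> l * (a * (11 * ?r * ?q - 8 * ?r\<^sup>2))"
    using l by (intro mult_left_mono) auto
  also have "\<dots> = ?m * (11 * ?r * ?q - 8 * ?r\<^sup>2)" by simp
  also have "\<dots> \<le> ?q\<^sup>2 / 2 - ?r\<^sup>2 / 8"
  proof -
    have "(11 * ?m * ?r - ?q)\<^sup>2 \<ge> 0" by simp
    hence "11 * ?m * ?r * ?q \<le> ?q\<^sup>2 / 2 + 121 / 2 * (?m * ?m) * ?r\<^sup>2"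
      by (simp add: power2_eq_square algebra_simps)
    moreover have "?m * ?m * ?r\<^sup>2 \<le> 1 / 22 * ?m * ?r\<^sup>2"
      using step by (intro mult_right_mono) auto
    moreover have "1 / 32 * ?r\<^sup>2 \<le> ?m * ?r\<^sup>2"
      using step by (intro mult_right_mono) auto
    moreover have "?r\<^sup>2 \<ge> 0" by simp
    moreover have "?m * (11 * ?r * ?q - 8 * ?r\<^sup>2) = 11 * ?m * ?r * ?q - 8 * (?m * ?r\<^sup>2)"
      by (simp only: right_diff_distrib mult_ac)
    ultimately show ?thesis by linarith
  qed
  finally show ?thesis .
qed

text \<open>
  Here \<open>w\<close> differs from \<open>g\<close> by at most \<open>(1 + 10) * a * r\<close>, and the tolerance is at most \<open>a * r * D\<close>.
\<close>

lemma regularised_step_gap: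
  fixes g w x u v :: "'a::real_inner"
  assumes err: "norm (g - (w - (10 * a) *\<^sub>R (x - v))) \<le> a * norm (x - v)"
    and tol: "inner w (x - u) \<le> a * (norm (x - v))\<^sup>2"
    and "a \<ge> 0" "norm (x - v) \<le> D" "norm (x - u) \<le> D"
  shows "inner g (x - u) \<le> 12 * a * norm (x - v) * D"
proof -
  let ?r = "norm (x - v)"
  let ?e = "g - (w - (10 * a) *\<^sub>R (x - v)) - (10 * a) *\<^sub>R (x - v)"
  have "norm ?e \<le> a * ?r + norm ((10 * a) *\<^sub>R (x - v))"
    using err by (rule order_trans[OF norm_triangle_ineq4 add_right_mono])
  hence "norm ?e \<le> 11 * a * ?r" using \<open>a \<ge> 0\<close> by simp
  hence "norm ?e * norm (x - u) \<le> (11 * a * ?r) * D"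
    using assms by (intro mult_mono) auto
  moreover have "inner ?e (x - u) \<le> norm ?e * norm (x - u)"
    by (rule norm_cauchy_schwarz)
  moreover have "a * ?r\<^sup>2 \<le> a * (?r * D)"
    using assms by (auto simp: power2_eq_square intro!: mult_left_mono)
  moreover have "inner g (x - u) = inner ?e (x - u) + inner w (x - u)"
    by (simp add: inner_diff_left)
  ultimately show ?thesis using tol by simp
qed

section \<open>Dual averaging\<close>

text \<open>
  The objective is quadratic with Hessian minus the identity, so along the segment from the
  maximiser \<open>y\<close> to \<open>u\<close> its increment is \<open>t * A - t\<^sup>2 / 2 * (norm (u - y))\<^sup>2\<close> with \<open>A\<close> the directional
  derivative at \<open>y\<close>. Maximality for small \<open>t\<close> forces \<open>A \<le> 0\<close>, and \<open>t = 1\<close> is the claim.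
\<close>

lemma dual_averaging_strong_concavity:
  fixes s y x0 u :: "'a::real_inner"
  assumes "is_arg_max (\<lambda>u. inner s (u - x0) - 1 / 2 * (norm (u - x0))\<^sup>2) (\<lambda>u. u \<in> X) y"
    and "convex X" "u \<in> X"
  shows "inner s (u - x0) - 1 / 2 * (norm (u - x0))\<^sup>2 + 1 / 2 * (norm (u - y))\<^sup>2
    \<le> inner s (y - x0) - 1 / 2 * (norm (y - x0))\<^sup>2"
proof -
  define \<phi> where "\<phi> u = inner s (u - x0) - 1 / 2 * (norm (u - x0))\<^sup>2" for u
  define A where "A = inner (s - (y - x0)) (u - y)"
  define N where "N = (norm (u - y))\<^sup>2"
  have max: "\<phi> z \<le> \<phi> y" if "z \<in> X" for z
    using assms(1) that by (auto simp: is_arg_max_linorder \<phi>_def)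
  have y: "y \<in> X" using assms(1) by (simp add: is_arg_max_def)
  have expand: "\<phi> (y + t *\<^sub>R (u - y)) = \<phi> y + t * A - t * t * N / 2" for t
  proof -
    have split: "y + t *\<^sub>R (u - y) - x0 = (y - x0) + t *\<^sub>R (u - y)" by simp
    have "(norm ((y - x0) + t *\<^sub>R (u - y)))\<^sup>2
        = (norm (y - x0))\<^sup>2 + 2 * (t * inner (y - x0) (u - y)) + t * t * N"
      unfolding N_def power2_norm_eq_inner
      by (simp only: inner_add_left inner_add_right inner_scaleR_left inner_scaleR_right
          inner_commute[of "u - y" "y - x0"]) (simp only: algebra_simps)
    moreover have "inner s ((y - x0) + t *\<^sub>R (u - y)) = inner s (y - x0) + t * inner s (u - y)"
      by (simp only: inner_add_right inner_scaleR_right)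
    moreover have "t * A = t * inner s (u - y) - t * inner (y - x0) (u - y)"
      by (simp only: A_def inner_diff_left[of s] right_diff_distrib)
    ultimately show ?thesis unfolding \<phi>_def split by linarith
  qed
  have small: "A \<le> t * N / 2" if "0 < t" "t \<le> 1" for t
  proof -
    have "y + t *\<^sub>R (u - y) \<in> X"
      using convexD_alt[OF \<open>convex X\<close> y \<open>u \<in> X\<close>, of t] that by (simp add: algebra_simps)
    hence "t * A \<le> t * (t * N / 2)" using max expand[of t] by fastforce
    thus ?thesis using that by simp
  qed
  have "A \<le> 0"
  proof (rule tendsto_lowerbound)
    show "((\<lambda>t. t * N / 2) \<longlongrightarrow> 0) (at_right 0)"
      by (auto intro!: tendsto_eq_intros)
    show "\<forall>\<^sub>F t in at_right 0. A \<le> t * N / 2"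
      using eventually_at_right_real[OF zero_less_one] by eventually_elim (rule small, auto)
  qed simp
  moreover have "\<phi> u = \<phi> y + A - N / 2" using expand[of 1] by simp
  ultimately show ?thesis by (simp add: \<phi>_def N_def)
qed

text \<open>
  Each step may lose \<open>(norm (u - v k))\<^sup>2 / 2\<close>, uniformly in the comparison point \<open>u\<close>. Bounding the
  dual averaging objective at all points of \<open>X\<close>, rather than only its maximum, makes the induction
  work: the hypothesis is applied at the next maximiser, whose strong concavity gain cancels the
  loss, and no maximiser beyond the last step has to exist.
\<close>

lemma dual_averaging_regret:
  fixes s g x v :: "nat \<Rightarrow> 'a::real_inner"
  assumes "convex X" and s0: "s 0 = 0"
    and max: "\<And>k. k < T \<Longrightarrow>
      is_arg_max (\<lambda>u. inner (s k) (u - x0) - 1 / 2 * (norm (u - x0))\<^sup>2) (\<lambda>u. u \<in> X) (v (Suc k))"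
    and s: "\<And>k. k < T \<Longrightarrow> s (Suc k) = s k - g (Suc k)"
    and step: "\<And>k u. k < T \<Longrightarrow> u \<in> X \<Longrightarrow>
      inner (g (Suc k)) (x (Suc k) - u) \<le> (norm (u - v (Suc k)))\<^sup>2 / 2 - c (Suc k)"
    and u: "u \<in> X"
  shows "(\<Sum>k=1..T. inner (g k) (x k - u)) + (\<Sum>k=1..T. c k) \<le> (norm (u - x0))\<^sup>2 / 2"
proof -
  have bound: "inner (s n) (u - x0) - 1 / 2 * (norm (u - x0))\<^sup>2
      \<le> - (\<Sum>k=1..n. inner (g k) (x k - x0) + c k)" if "n \<le> T" "u \<in> X" for n u
    using that
  proof (induction n arbitrary: u)
    case 0
    thus ?case by (simp add: s0)
  next
    case (Suc n)
    hence n: "n < T" by simp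
    have "v (Suc n) \<in> X" using max[OF n] by (simp add: is_arg_max_def)
    with Suc.IH[of "v (Suc n)"] n
    have "inner (s n) (v (Suc n) - x0) - 1 / 2 * (norm (v (Suc n) - x0))\<^sup>2
      \<le> - (\<Sum>k=1..n. inner (g k) (x k - x0) + c k)" by simp
    moreover note dual_averaging_strong_concavity[OF max[OF n] \<open>convex X\<close> \<open>u \<in> X\<close>]
      step[OF n \<open>u \<in> X\<close>]
    moreover have "inner (g (Suc n)) (x (Suc n) - u)
      = inner (g (Suc n)) (x (Suc n) - x0) - inner (g (Suc n)) (u - x0)"
      by (simp add: inner_diff_right)
    ultimately show ?case by (simp add: s[OF n] inner_diff_left)
  qed
  have sT: "n \<le> T \<Longrightarrow> s n = - (\<Sum>k=1..n. g k)" for n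
    by (induction n) (auto simp: s0 s)
  have "inner (s T) (u - x0) = - (\<Sum>k=1..T. inner (g k) (u - x0))"
    by (simp add: sT inner_sum_left)
  moreover have "(\<Sum>k=1..T. inner (g k) (x k - u))
      = (\<Sum>k=1..T. inner (g k) (x k - x0)) - (\<Sum>k=1..T. inner (g k) (u - x0))"
    by (simp add: inner_diff_right flip: sum_subtractf)
  ultimately show ?thesis
    using bound[OF order_refl u] by (simp add: sum.distrib)
qed

section \<open>The rate for the gap\<close>

lemma inner_le_gap:
  assumes "bounded X" "u \<in> X"
  shows "inner (G y) (y - u) \<le> gap X G y"
proof -
  obtain B where B: "\<And>x. x \<in> X \<Longrightarrow> norm x \<le> B"
    using \<open>bounded X\<close> by (auto simp: bounded_iff)
  have "inner (G y) (y - x) \<le> norm (G y) * (norm y + B)" if "x \<in> X" for x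
  proof -
    have "norm (y - x) \<le> norm y + B"
      using norm_triangle_ineq4[of y x] B[OF that] by simp
    hence "norm (G y) * norm (y - x) \<le> norm (G y) * (norm y + B)"
      by (intro mult_left_mono) auto
    thus ?thesis using norm_cauchy_schwarz[of "G y" "y - x"] by linarith
  qed
  hence "bdd_above ((\<lambda>x. inner (G y) (y - x)) ` X)" by (rule bdd_aboveI2)
  thus ?thesis unfolding gap_def by (rule cSUP_upper[OF \<open>u \<in> X\<close>])
qed

lemma min_le_of_sum_squares_le:
  fixes r :: "nat \<Rightarrow> real"
  assumes "T \<ge> 1" "D \<ge> 0"
    and sum: "(\<Sum>k=1..T. (r k)\<^sup>2) \<le> 4 * D\<^sup>2"
    and min: "\<And>k. 1 \<le> k \<Longrightarrow> k \<le> T \<Longrightarrow> m \<le> r k" and "m \<ge> 0"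
  shows "m \<le> 2 * D / sqrt T"
proof -
  have "real T * m\<^sup>2 = (\<Sum>k=1..T. m\<^sup>2)" by simp
  also have "\<dots> \<le> (\<Sum>k=1..T. (r k)\<^sup>2)"
    using min \<open>m \<ge> 0\<close> by (intro sum_mono power_mono) auto
  finally have "(sqrt T * m)\<^sup>2 \<le> (2 * D)\<^sup>2"
    using sum by (simp add: power_mult_distrib)
  hence "sqrt T * m \<le> 2 * D"
    by (rule power2_le_imp_le) (use \<open>D \<ge> 0\<close> in simp)
  thus ?thesis using \<open>T \<ge> 1\<close> by (simp add: field_simps)
qed

theorem theorem3p4:
  shows "\<exists>C>0. \<forall>(d::nat) (X :: evec set) (F :: evec \<Rightarrow> evec)
      (DF :: evec \<Rightarrow> nat \<Rightarrow> nat \<Rightarrow> real) (J :: evec \<Rightarrow> nat \<Rightarrow> nat \<Rightarrow> real)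
      (L1::real) (\<delta>::real) (T::nat) (x :: nat \<Rightarrow> evec) (v :: nat \<Rightarrow> evec)
      (lam :: nat \<Rightarrow> real) (s :: nat \<Rightarrow> evec) (kT::nat).
    X \<subseteq> Rn d \<and> X \<noteq> {} \<and> closed X \<and> bounded X \<and> convex X \<and>
    F ` X \<subseteq> Rn d \<and> continuous_on X F \<and>
    L1 \<ge> 0 \<and> jacobian_on d X F DF \<and> smooth_jacobian d X DF L1 \<and>
    minty X F \<and>
    \<delta> \<ge> 0 \<and> inexact_jacobian d X DF J \<delta> \<and>
    T \<ge> 1 \<and> VIJI_run d X F J L1 \<delta> 10 (\<lambda>_. \<delta>) T x v lam s \<and>
    is_arg_min (\<lambda>k. norm (x k - v k)) (\<lambda>k. 1 \<le> k \<and> k \<le> T) kT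
    \<longrightarrow> gap X F (x kT) \<le> C * (L1 * diameter X ^ 3 / T + \<delta> * (diameter X)\<^sup>2 / sqrt T)"
proof (intro exI[of _ 24] conjI allI impI)
  fix d X F DF J T kT and L1 \<delta> :: real and x v s :: "nat \<Rightarrow> evec" and lam :: "nat \<Rightarrow> real"
  assume H: "X \<subseteq> Rn d \<and> X \<noteq> {} \<and> closed X \<and> bounded X \<and> convex X \<and>
    F ` X \<subseteq> Rn d \<and> continuous_on X F \<and>
    L1 \<ge> 0 \<and> jacobian_on d X F DF \<and> smooth_jacobian d X DF L1 \<and>
    minty X F \<and>
    \<delta> \<ge> 0 \<and> inexact_jacobian d X DF J \<delta> \<and>
    T \<ge> 1 \<and> VIJI_run d X F J L1 \<delta> 10 (\<lambda>_. \<delta>) T x v lam s \<and>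
    is_arg_min (\<lambda>k. norm (x k - v k)) (\<lambda>k. 1 \<le> k \<and> k \<le> T) kT"
  hence X: "X \<noteq> {}" "bounded X" "convex X"
    and jac: "jacobian_on d X F DF" "smooth_jacobian d X DF L1" "inexact_jacobian d X DF J \<delta>"
    and "L1 \<ge> 0" "\<delta> \<ge> 0" "T \<ge> 1"
    and run: "VIJI_run d X F J L1 \<delta> 10 (\<lambda>_. \<delta>) T x v lam s"
    and kT: "1 \<le> kT" "kT \<le> T"
    and kT_min: "\<And>k. 1 \<le> k \<Longrightarrow> k \<le> T \<Longrightarrow> norm (x kT - v kT) \<le> norm (x k - v k)"
    by (auto simp: is_arg_min_linorder)
  from H obtain xs where xs: "xs \<in> X" "\<And>y. y \<in> X \<Longrightarrow> inner (F y) (y - xs) \<ge> 0"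
    by (auto simp: minty_def)
  define D where "D = diameter X"
  define r where "r k = norm (x k - v k)" for k
  define a where "a k = L1 / 2 * r k + \<delta>" for k
  define w where "w k = Omega d F J L1 \<delta> 10 (v k) (x k)" for k
  have D: "norm (y - z) \<le> D" if "y \<in> X" "z \<in> X" for y z
    using diameter_bounded_bound[OF \<open>bounded X\<close> that] by (simp add: D_def dist_norm)
  have "D \<ge> 0" using D[OF xs(1) xs(1)] by simp
  have r: "r k \<ge> 0" and a: "a k \<ge> 0" for k
    using \<open>L1 \<ge> 0\<close> \<open>\<delta> \<ge> 0\<close> by (auto simp: r_def a_def)
  have x0: "x 0 \<in> X" and s0: "s 0 = 0"
    using run by (auto simp: VIJI_run_def)
  have v_max: "is_arg_max (\<lambda>u. inner (s k) (u - x 0) - 1 / 2 * (norm (u - x 0))\<^sup>2)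
      (\<lambda>u. u \<in> X) (v (Suc k))"
    and x_in: "x (Suc k) \<in> X"
    and lam: "1 / 32 \<le> lam (Suc k) * a (Suc k)" "lam (Suc k) * a (Suc k) \<le> 1 / 22"
    and s: "s (Suc k) = s k - lam (Suc k) *\<^sub>R F (x (Suc k))" if "k < T" for k
    using run that by (auto simp: VIJI_run_def a_def r_def)
  have v_in: "v (Suc k) \<in> X" if "k < T" for k
    using v_max[OF that] by (simp add: is_arg_max_def)
  have tol: "inner (w (Suc k)) (x (Suc k) - u) \<le> a (Suc k) * (norm (x (Suc k) - v (Suc k)))\<^sup>2"
    if "k < T" "u \<in> X" for k u
  proof -
    have "inner (w (Suc k)) (x (Suc k) - u)
        \<le> gap X (Omega d F J L1 \<delta> 10 (v (Suc k))) (x (Suc k))"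
      unfolding w_def using \<open>bounded X\<close> \<open>u \<in> X\<close> by (rule inner_le_gap)
    also have "\<dots> \<le> L1 / 2 * norm (x (Suc k) - v (Suc k)) ^ 3
        + \<delta> * (norm (x (Suc k) - v (Suc k)))\<^sup>2"
      using run \<open>k < T\<close> by (simp add: VIJI_run_def)
    finally show ?thesis
      by (simp add: a_def r_def power2_eq_square power3_eq_cube algebra_simps)
  qed
  have err: "norm (F (x (Suc k)) - (w (Suc k) - (10 * a (Suc k)) *\<^sub>R (x (Suc k) - v (Suc k))))
      \<le> a (Suc k) * norm (x (Suc k) - v (Suc k))" if "k < T" for k
  proof -
    have "w (Suc k) - (10 * a (Suc k)) *\<^sub>R (x (Suc k) - v (Suc k))
        = Psi d F J (v (Suc k)) (x (Suc k))"
      by (simp add: w_def Omega_def a_def r_def flip: scaleR_add_left)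
    thus ?thesis
      using Psi_error[OF \<open>convex X\<close> v_in x_in jac] that by (simp add: a_def r_def)
  qed

  have sum: "(\<Sum>k=1..T. (r k)\<^sup>2) \<le> 4 * D\<^sup>2"
  proof -
    have lam_pos: "lam (Suc k) > 0" if "k < T" for k
      using lam(1)[OF that] a[of "Suc k"]
      by (smt (verit) divide_pos_pos mult_nonneg_nonneg mult_nonpos_nonneg)
    have "(\<Sum>k=1..T. inner (lam k *\<^sub>R F (x k)) (x k - xs)) + (\<Sum>k=1..T. (r k)\<^sup>2 / 8)
        \<le> (norm (xs - x 0))\<^sup>2 / 2"
    proof (rule dual_averaging_regret
        [where s = s and g = "\<lambda>k. lam k *\<^sub>R F (x k)" and x = x and v = v and c = "\<lambda>k. (r k)\<^sup>2 / 8"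
          and T = T, OF \<open>convex X\<close> s0 v_max s _ xs(1)])
      fix k u assume k: "k < T" and u: "u \<in> X"
      have "lam (Suc k) * inner (F (x (Suc k))) (x (Suc k) - u)
          \<le> (norm (u - v (Suc k)))\<^sup>2 / 2 - (norm (x (Suc k) - v (Suc k)))\<^sup>2 / 8"
        using err[OF k] tol[OF k u] less_imp_le[OF lam_pos[OF k]] lam[OF k]
        by (rule regularised_step_descent)
      thus "inner (lam (Suc k) *\<^sub>R F (x (Suc k))) (x (Suc k) - u)
          \<le> (norm (u - v (Suc k)))\<^sup>2 / 2 - (r (Suc k))\<^sup>2 / 8"
        by (simp add: r_def)
    qed
    moreover have "(\<Sum>k=1..T. inner (lam k *\<^sub>R F (x k)) (x k - xs)) \<ge> 0"
    proof (rule sum_nonneg)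
      fix k assume "k \<in> {1..T}"
      then obtain j where j: "k = Suc j" "j < T" by (cases k) auto
      show "inner (lam k *\<^sub>R F (x k)) (x k - xs) \<ge> 0"
        using lam_pos[OF j(2)] xs(2)[OF x_in[OF j(2)]] by (simp add: j)
    qed
    moreover have "(norm (xs - x 0))\<^sup>2 \<le> D\<^sup>2"
      using D[OF xs(1) x0] by (intro power_mono) auto
    ultimately show ?thesis by (simp flip: sum_divide_distrib)
  qed
  have rT: "r kT \<le> 2 * D / sqrt T"
    using kT_min sum \<open>T \<ge> 1\<close> \<open>D \<ge> 0\<close> by (intro min_le_of_sum_squares_le[where r = r]) (auto simp: r_def)

  obtain j where j: "kT = Suc j" "j < T" using kT by (cases kT) auto
  have "inner (F (x kT)) (x kT - u) \<le> 12 * a kT * r kT * D" if "u \<in> X" for u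
    using err[OF j(2)] tol[OF j(2) that] a D v_in x_in j that
    unfolding r_def by (intro regularised_step_gap) auto
  hence "gap X F (x kT) \<le> 12 * a kT * r kT * D"
    unfolding gap_def using X(1) by (intro cSUP_least)
  also have "\<dots> = 12 * D * (L1 / 2 * (r kT)\<^sup>2 + \<delta> * r kT)"
    by (simp add: a_def power2_eq_square algebra_simps)
  also have "\<dots> \<le> 12 * D * (L1 / 2 * (2 * D / sqrt T)\<^sup>2 + \<delta> * (2 * D / sqrt T))"
    using rT r \<open>D \<ge> 0\<close> \<open>L1 \<ge> 0\<close> \<open>\<delta> \<ge> 0\<close>
    by (intro mult_left_mono add_mono power_mono) auto
  also have "\<dots> = 24 * (L1 * D ^ 3 / T + \<delta> * D\<^sup>2 / sqrt T)"
    using \<open>T \<ge> 1\<close> by (simp add: power2_eq_square power3_eq_cube field_simps)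
  finally show "gap X F (x kT)
      \<le> 24 * (L1 * diameter X ^ 3 / T + \<delta> * (diameter X)\<^sup>2 / sqrt T)"
    by (simp add: D_def)
qed simp

end
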